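(* Let $S$ be an additively idempotent semiring. A $k$-ideal $I$ of $S$ is $k$-semiprime if and only if for all $x\in S$ and $z\in I$, $x^2\leqslant z$ implies $x\in I$.
   Context: A semiring is a commutative semiring $(S,+,0,\cdot,1)$ with multiplicative identity $1$ and additive identity $0$ that is absorbing. It is additively idempotent if $x+x=x$ for all $x$; then the natural partial order is $x\leqslant y\iff x+y=y$. An ideal is a nonempty subset closed under addition and under multiplication by elements of $S$. A $k$-ideal is an ideal $I$ such that $x+y\in I$ and $y\in I$ imply $x\in I$. A $k$-ideal $I$ is $k$-semiprime if for every $k$-ideal $A$, $A^2\subseteq I$ implies $A\subseteq I$, where $A^2$ is the ideal of finite sums of products $ab$ with $a,b\in A$. *)

theory Defs
  imports Main
begin

(* The type class comm_semiring_1 would impose 0 ~= 1; the combination used here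
   also admits the one-element semiring. *)
class comm_semiring_unit = comm_semiring_0 + comm_monoid_mult

definition natural_le :: "'a::comm_semiring_unit \<Rightarrow> 'a \<Rightarrow> bool"  (infix "\<preceq>" 50)
  where "x \<preceq> y \<longleftrightarrow> x + y = y"

definition semiring_ideal :: "'a::comm_semiring_unit set \<Rightarrow> bool"
  where "semiring_ideal I \<longleftrightarrow>
    I \<noteq> {} \<and> (\<forall>x\<in>I. \<forall>y\<in>I. x + y \<in> I) \<and> (\<forall>s. \<forall>x\<in>I. s * x \<in> I)"

definition k_ideal :: "'a::comm_semiring_unit set \<Rightarrow> bool"
  where "k_ideal I \<longleftrightarrow>
    semiring_ideal I \<and> (\<forall>x y. x + y \<in> I \<and> y \<in> I \<longrightarrow> x \<in> I)"

definition ideal_square :: "'a::comm_semiring_unit set \<Rightarrow> 'a set"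
  where "ideal_square A =
    {\<Sum>i<n. a i * b i | (n::nat) a b. \<forall>i<n. a i \<in> A \<and> b i \<in> A}"

definition k_semiprime :: "'a::comm_semiring_unit set \<Rightarrow> bool"
  where "k_semiprime I \<longleftrightarrow>
    k_ideal I \<and> (\<forall>A. k_ideal A \<longrightarrow> ideal_square A \<subseteq> I \<longrightarrow> A \<subseteq> I)"

end

(* In an additively idempotent semiring the k-ideal generated by x is the set of all y
   with y \<preceq> s * x for some s, and the products of two of its elements lie below
   multiples of x^2. *)
theory Submission
  imports Defs
begin

text \<open>A k-ideal is closed downward under \<open>\<preceq>\<close>, and idempotence makes
  \<open>\<preceq>\<close> reflexive, so the condition on \<open>I\<close> amounts to: a square in
  \<open>I\<close> has its root in \<open>I\<close>. If \<open>I\<close> is k-semiprime and the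
  square of \<open>x\<close> is in \<open>I\<close>, take \<open>A\<close> to be the k-ideal of all
  elements below a multiple of \<open>x\<close> (\<open>k_ideal_principal\<close>). Products in
  \<open>A\<close> lie below multiples of the square of \<open>x\<close>, so the ideal square of
  \<open>A\<close> lies in \<open>I\<close>, and hence so does \<open>x\<close>. Conversely, each
  \<open>x\<close> in \<open>A\<close> has its square in \<open>ideal_square A\<close>.\<close>

lemma k_ideal_add: "k_ideal I \<Longrightarrow> x \<in> I \<Longrightarrow> y \<in> I \<Longrightarrow> x + y \<in> I"
  and k_ideal_mult: "k_ideal I \<Longrightarrow> x \<in> I \<Longrightarrow> s * x \<in> I"
  and k_ideal_cancel: "k_ideal I \<Longrightarrow> x + y \<in> I \<Longrightarrow> y \<in> I \<Longrightarrow> x \<in> I"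
  unfolding k_ideal_def semiring_ideal_def by blast+

lemma k_ideal_zero:
  assumes "k_ideal I"
  shows "0 \<in> I"
proof -
  obtain x where "x \<in> I"
    using assms unfolding k_ideal_def semiring_ideal_def by blast
  then show ?thesis
    using k_ideal_mult[OF assms, of x 0] by simp
qed

text \<open>Here \<open>x + z\<close> equals \<open>z\<close>, which is in \<open>I\<close>, so
  cancelling \<open>z\<close> leaves \<open>x\<close> in \<open>I\<close>.\<close>

lemma k_ideal_downward_closed:
  assumes "k_ideal I" "x \<preceq> z" "z \<in> I"
  shows "x \<in> I"
  using assms k_ideal_cancel[of I x z] by (simp add: natural_le_def)

lemma k_ideal_sum:
  assumes "k_ideal I" "\<And>i. i < n \<Longrightarrow> f i \<in> I"
  shows "(\<Sum>i<n::nat. f i) \<in> I"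
  using assms(2)
  by (induction n) (simp_all add: k_ideal_zero[OF assms(1)] k_ideal_add[OF assms(1)])

text \<open>Closure of \<open>I\<close> under finite sums, including the empty sum 0, reduces the
  inclusion to single products.\<close>

lemma ideal_square_subset:
  assumes "k_ideal I" "\<And>a b. a \<in> A \<Longrightarrow> b \<in> A \<Longrightarrow> a * b \<in> I"
  shows "ideal_square A \<subseteq> I"
  using assms unfolding ideal_square_def by (auto intro!: k_ideal_sum)

lemma square_mem_ideal_square:
  assumes "x \<in> A"
  shows "x\<^sup>2 \<in> ideal_square A"
  unfolding ideal_square_def
  \<comment> \<open>The square is a sum with one term, both factors being \<open>x\<close>.\<close>
  by (intro CollectI exI[of _ 1] exI[of _ "\<lambda>_. x"]) (simp add: assms power2_eq_square)

lemma natural_le_add: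
  assumes "a \<preceq> b" "c \<preceq> d"
  shows "a + c \<preceq> b + d"
  using assms unfolding natural_le_def by (metis add.assoc add.commute)

lemma natural_le_mult_left:
  assumes "a \<preceq> b"
  shows "c * a \<preceq> c * b"
  using assms unfolding natural_le_def by (metis distrib_left)

lemma natural_le_trans:
  assumes "a \<preceq> b" "b \<preceq> c"
  shows "a \<preceq> c"
  using assms unfolding natural_le_def by (metis add.assoc)

text \<open>The chain goes through \<open>a * d\<close>, with commutativity turning left
  multiplication by \<open>d\<close> into right multiplication.\<close>

lemma natural_le_mult:
  assumes "a \<preceq> b" "c \<preceq> d"
  shows "a * c \<preceq> b * d"
  using natural_le_mult_left[OF assms(2), of a] natural_le_mult_left[OF assms(1), of d]
  by (metis mult.commute natural_le_trans)

lemma k_ideal_principal: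
  fixes x :: "'a::comm_semiring_unit"
  assumes idem: "\<And>x::'a. x + x = x"
  shows "k_ideal {y. \<exists>s. y \<preceq> s * x}"
  unfolding k_ideal_def semiring_ideal_def
proof (intro conjI ballI allI impI; (elim conjE)?)
  have "x \<preceq> 1 * x"
    by (simp add: natural_le_def idem)
  then show "{y. \<exists>s. y \<preceq> s * x} \<noteq> {}"
    by blast
next
  fix a b
  assume "a \<in> {y. \<exists>s. y \<preceq> s * x}" "b \<in> {y. \<exists>s. y \<preceq> s * x}"
  then obtain s t where "a \<preceq> s * x" "b \<preceq> t * x"
    by blast
  then have "a + b \<preceq> (s + t) * x"
    by (simp add: natural_le_add distrib_right)
  then show "a + b \<in> {y. \<exists>s. y \<preceq> s * x}"
    by blast
next
  fix r a
  assume "a \<in> {y. \<exists>s. y \<preceq> s * x}"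
  then obtain s where "a \<preceq> s * x"
    by blast
  then have "r * a \<preceq> (r * s) * x"
    by (simp add: natural_le_mult_left mult.assoc)
  then show "r * a \<in> {y. \<exists>s. y \<preceq> s * x}"
    by blast
next
  fix a b
  assume "a + b \<in> {y. \<exists>s. y \<preceq> s * x}"
  then obtain s where "a + b \<preceq> s * x"
    by blast
  \<comment> \<open>Idempotence gives \<open>a + (a + b) = a + b\<close>; cancellation in the set is
    thus downward closure.\<close>
  moreover have "a \<preceq> a + b"
    by (simp add: natural_le_def idem flip: add.assoc)
  ultimately show "a \<in> {y. \<exists>s. y \<preceq> s * x}"
    using natural_le_trans by blast
qed

theorem theorem6p16:
  fixes I :: "'a::comm_semiring_unit set"
  assumes "\<And>x::'a. x + x = x"
    and "k_ideal I"
  shows "k_semiprime I \<longleftrightarrow> (\<forall>x. \<forall>z\<in>I. x\<^sup>2 \<preceq> z \<longrightarrow> x \<in> I)"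
proof (intro iffI allI ballI impI)
  fix x z
  assume semiprime: "k_semiprime I" and "z \<in> I" "x\<^sup>2 \<preceq> z"
  then have x2: "x\<^sup>2 \<in> I"
    using assms(2) k_ideal_downward_closed by blast
  let ?A = "{y. \<exists>s. y \<preceq> s * x}"
  have "ideal_square ?A \<subseteq> I"
  proof (rule ideal_square_subset[OF assms(2)])
    fix a b
    assume "a \<in> ?A" "b \<in> ?A"
    then obtain s t where "a \<preceq> s * x" "b \<preceq> t * x"
      by blast
    \<comment> \<open>Multiply the two bounds and regroup \<open>(s * x) * (t * x)\<close>.\<close>
    then have "a * b \<preceq> (s * t) * x\<^sup>2"
      using natural_le_mult by (fastforce simp: power2_eq_square ac_simps)
    then show "a * b \<in> I"
      using k_ideal_downward_closed k_ideal_mult assms(2) x2 by blast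
  qed
  then have "?A \<subseteq> I"
    using semiprime k_ideal_principal[OF assms(1)] unfolding k_semiprime_def by blast
  \<comment> \<open>The multiplier 1 places \<open>x\<close> itself in \<open>?A\<close>.\<close>
  moreover have "x \<preceq> 1 * x"
    by (simp add: natural_le_def assms(1))
  ultimately show "x \<in> I"
    by blast
next
  assume *: "\<forall>x. \<forall>z\<in>I. x\<^sup>2 \<preceq> z \<longrightarrow> x \<in> I"
  have "x \<in> I" if "ideal_square A \<subseteq> I" "x \<in> A" for A x
    \<comment> \<open>The hypothesis is applied with \<open>z\<close> equal to the square of
      \<open>x\<close>; idempotence supplies reflexivity of \<open>\<preceq>\<close> there.\<close>
    using * that square_mem_ideal_square[of x A] assms(1)[of "x\<^sup>2"]
    unfolding natural_le_def by blast
  with assms(2) show "k_semiprime I"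
    unfolding k_semiprime_def by blast
qed

end
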